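(* Let $t_0\in\mathbb{R}$, let $1\le p\le\infty$, and let $X\neq\{0\}$ be a Banach space. For every $\alpha>0$, the Riemann-Liouville fractional integral of order $\alpha$ is not well-defined as an operator from $L^p(t_0,\infty;X)$ into itself; that is, there exists $f\in L^p(t_0,\infty;X)$ such that $t\mapsto J^\alpha_{t_0,t}f(t)$ does not belong to $L^p(t_0,\infty;X)$.
   Context: $L^p(t_0,\infty;X)$ is the Bochner-Lebesgue space on $[t_0,\infty)$ with Lebesgue measure. The Riemann-Liouville fractional integral of order $\alpha>0$ is $J^\alpha_{t_0,t}f(t):=\frac{1}{\Gamma(\alpha)}\int_{t_0}^t(t-s)^{\alpha-1}f(s)\,ds$ (Bochner integral), for every $t\in[t_0,\infty)$ for which it exists; for $f\in L^p(t_0,\infty;X)$ it exists for almost every $t$. *)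

theory Defs
  imports "HOL-Analysis.Analysis"
begin

text \<open>
  The library's \<open>has_bochner_integral\<close>, \<open>integrable\<close> and \<open>lebesgue_integral\<close> are restricted to
  second countable (that is, separable) target spaces. The notions below are the usual Bochner ones
  for an arbitrary normed space; they are built from the library's integrable simple functions and
  their integrals, which carry no such restriction. Borel measurability is replaced by strong
  measurability (almost everywhere limit of integrable simple functions).
\<close>

definition strongly_measurable :: "'a measure \<Rightarrow> ('a \<Rightarrow> 'b::real_normed_vector) \<Rightarrow> bool" where
  "strongly_measurable M f \<longleftrightarrow>
     (\<exists>s. (\<forall>i::nat. Bochner_Integration.simple_bochner_integrable M (s i)) \<and> (AE x in M. (\<lambda>i. s i x) \<longlonglongrightarrow> f x))"

definition has_Bochner_integral ::
    "'a measure \<Rightarrow> ('a \<Rightarrow> 'b::real_normed_vector) \<Rightarrow> 'b \<Rightarrow> bool" where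
  "has_Bochner_integral M f I \<longleftrightarrow>
     strongly_measurable M f \<and>
     (\<exists>s. (\<forall>i::nat. Bochner_Integration.simple_bochner_integrable M (s i)) \<and>
          (\<lambda>i. \<integral>\<^sup>+x. ennreal (norm (f x - s i x)) \<partial>M) \<longlonglongrightarrow> 0 \<and>
          (\<lambda>i. Bochner_Integration.simple_bochner_integral M (s i)) \<longlonglongrightarrow> I)"

definition Bochner_integral :: "'a measure \<Rightarrow> ('a \<Rightarrow> 'b::real_normed_vector) \<Rightarrow> 'b" where
  "Bochner_integral M f =
     (if \<exists>I. has_Bochner_integral M f I then THE I. has_Bochner_integral M f I else 0)"

lemma nn_integral_norm_diff_add:
  fixes f :: "'a \<Rightarrow> 'b::real_normed_vector"
  assumes f: "strongly_measurable M f"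
    and s: "Bochner_Integration.simple_bochner_integrable M s" and t: "Bochner_Integration.simple_bochner_integrable M t"
  shows "(\<integral>\<^sup>+x. ennreal (norm (f x - s x)) + ennreal (norm (f x - t x)) \<partial>M) =
    (\<integral>\<^sup>+x. ennreal (norm (f x - s x)) \<partial>M) + (\<integral>\<^sup>+x. ennreal (norm (f x - t x)) \<partial>M)"
proof -
  obtain u where u: "\<And>i::nat. Bochner_Integration.simple_bochner_integrable M (u i)"
    and lim: "AE x in M. (\<lambda>i. u i x) \<longlonglongrightarrow> f x"
    using f unfolding strongly_measurable_def by blast
  define G where "G r = (\<lambda>x. lim (\<lambda>i. norm (u i x - r x)))" for r :: "'a \<Rightarrow> 'b"
  have meas: "G r \<in> borel_measurable M" if r: "Bochner_Integration.simple_bochner_integrable M r" for r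
  proof -
    have "(\<lambda>x. norm (u i x - r x)) \<in> borel_measurable M" for i
      using simple_bochner_integrable_compose2[of "\<lambda>x y. norm (x - y)" M "u i" r] u r
      by (auto elim!: Bochner_Integration.simple_bochner_integrable.cases intro: borel_measurable_simple_function)
    then show ?thesis unfolding G_def by (rule borel_measurable_lim_metric)
  qed
  have ae: "AE x in M. norm (f x - r x) = G r x" for r
    using lim by eventually_elim (auto simp: G_def intro!: limI[symmetric] tendsto_intros)
  have "(\<integral>\<^sup>+x. ennreal (norm (f x - s x)) + ennreal (norm (f x - t x)) \<partial>M) =
      (\<integral>\<^sup>+x. ennreal (G s x) + ennreal (G t x) \<partial>M)"
    by (rule nn_integral_cong_AE) (use ae[of s] ae[of t] in \<open>eventually_elim, simp\<close>)
  also have "\<dots> = (\<integral>\<^sup>+x. ennreal (G s x) \<partial>M) + (\<integral>\<^sup>+x. ennreal (G t x) \<partial>M)"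
    using meas[OF s] meas[OF t] by (intro nn_integral_add) auto
  also have "(\<integral>\<^sup>+x. ennreal (G s x) \<partial>M) = (\<integral>\<^sup>+x. ennreal (norm (f x - s x)) \<partial>M)"
    by (rule nn_integral_cong_AE) (use ae[of s] in \<open>eventually_elim, simp\<close>)
  also have "(\<integral>\<^sup>+x. ennreal (G t x) \<partial>M) = (\<integral>\<^sup>+x. ennreal (norm (f x - t x)) \<partial>M)"
    by (rule nn_integral_cong_AE) (use ae[of t] in \<open>eventually_elim, simp\<close>)
  finally show ?thesis .
qed

lemma has_Bochner_integral_unique:
  assumes "has_Bochner_integral M f I" and "has_Bochner_integral M f J"
  shows "I = J"
proof -
  have f: "strongly_measurable M f" using assms(1) by (simp add: has_Bochner_integral_def)
  obtain s where s: "\<And>i::nat. Bochner_Integration.simple_bochner_integrable M (s i)"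
    and s0: "(\<lambda>i. \<integral>\<^sup>+x. ennreal (norm (f x - s i x)) \<partial>M) \<longlonglongrightarrow> 0"
    and sI: "(\<lambda>i. Bochner_Integration.simple_bochner_integral M (s i)) \<longlonglongrightarrow> I"
    using assms(1) unfolding has_Bochner_integral_def by blast
  obtain t where t: "\<And>i::nat. Bochner_Integration.simple_bochner_integrable M (t i)"
    and t0: "(\<lambda>i. \<integral>\<^sup>+x. ennreal (norm (f x - t i x)) \<partial>M) \<longlonglongrightarrow> 0"
    and tJ: "(\<lambda>i. Bochner_Integration.simple_bochner_integral M (t i)) \<longlonglongrightarrow> J"
    using assms(2) unfolding has_Bochner_integral_def by blast
  let ?d = "\<lambda>i. norm (Bochner_Integration.simple_bochner_integral M (s i) - Bochner_Integration.simple_bochner_integral M (t i))"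
  let ?b = "\<lambda>i. (\<integral>\<^sup>+x. ennreal (norm (f x - s i x)) \<partial>M) + (\<integral>\<^sup>+x. ennreal (norm (f x - t i x)) \<partial>M)"
  have bound: "ennreal (?d i) \<le> ?b i" for i
  proof -
    have d: "Bochner_Integration.simple_bochner_integrable M (\<lambda>x. s i x - t i x)"
      and n: "Bochner_Integration.simple_bochner_integrable M (\<lambda>x. norm (s i x - t i x))"
      using simple_bochner_integrable_compose2[of "\<lambda>x y. x - y" M "s i" "t i"]
        simple_bochner_integrable_compose2[of "\<lambda>x y. norm (x - y)" M "s i" "t i"] s t by simp_all
    have "?d i \<le> Bochner_Integration.simple_bochner_integral M (\<lambda>x. norm (s i x - t i x))"
      using simple_bochner_integral_norm_bound[OF d] by (simp add: simple_bochner_integral_diff s t)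
    then have "ennreal (?d i) \<le> (\<integral>\<^sup>+x. ennreal (norm (s i x - t i x)) \<partial>M)"
      using simple_bochner_integral_eq_nn_integral[OF n] by (metis ennreal_leI norm_ge_zero)
    also have "\<dots> \<le> (\<integral>\<^sup>+x. ennreal (norm (f x - s i x)) + ennreal (norm (f x - t i x)) \<partial>M)"
    proof (rule nn_integral_mono)
      fix x
      have "norm (s i x - t i x) \<le> norm (f x - s i x) + norm (f x - t i x)"
        by (metis norm_minus_commute norm_diff_triangle_le order_refl)
      then show "ennreal (norm (s i x - t i x)) \<le>
          ennreal (norm (f x - s i x)) + ennreal (norm (f x - t i x))"
        by (metis ennreal_leI ennreal_plus norm_ge_zero)
    qed
    finally show ?thesis by (simp add: nn_integral_norm_diff_add[OF f s t])
  qed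
  have "?b \<longlonglongrightarrow> 0" using tendsto_add[OF s0 t0] by simp
  then have "(\<lambda>i. ennreal (?d i)) \<longlonglongrightarrow> 0"
    by (rule tendsto_sandwich[OF _ _ tendsto_const, rotated 2]) (use bound in auto)
  then have "?d \<longlonglongrightarrow> 0" by (simp flip: ennreal_0)
  moreover have "?d \<longlonglongrightarrow> norm (I - J)" using sI tJ by (intro tendsto_intros)
  ultimately show "I = J" using LIMSEQ_unique by fastforce
qed

lemma Bochner_integral_eq:
  "has_Bochner_integral M f I \<Longrightarrow> Bochner_integral M f = I"
  unfolding Bochner_integral_def by (auto intro: has_Bochner_integral_unique)

text \<open>
  Elements of \<open>L\<^sup>p\<close> are represented by functions rather than by almost everywhere classes; membership
  only depends on the class. For \<open>p = \<infinity>\<close> the condition is essential boundedness.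
\<close>

definition Bochner_Lp :: "ennreal \<Rightarrow> 'a measure \<Rightarrow> ('a \<Rightarrow> 'b::real_normed_vector) set" where
  "Bochner_Lp p M =
     {f. strongly_measurable M f \<and>
         (if p = \<infinity> then \<exists>C::real. AE x in M. norm (f x) \<le> C
          else (\<integral>\<^sup>+x. ennreal (norm (f x) powr enn2real p) \<partial>M) < \<infinity>)}"

text \<open>
  The value is \<open>0\<close> at those \<open>t\<close> where the integral does not exist. For \<open>f\<close> in \<open>L\<^sup>p(t\<^sub>0,\<infinity>;X)\<close> these
  form a null set, so they do not affect whether the result belongs to \<open>L\<^sup>p(t\<^sub>0,\<infinity>;X)\<close>. The value of
  the kernel at the single point \<open>s = t\<close>, where \<open>0 powr (\<alpha> - 1) = 0\<close>, is irrelevant as well.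
\<close>

definition RL_integral ::
    "real \<Rightarrow> real \<Rightarrow> (real \<Rightarrow> 'b::real_normed_vector) \<Rightarrow> real \<Rightarrow> 'b" where
  "RL_integral \<alpha> t\<^sub>0 f t =
     (1 / Gamma \<alpha>) *\<^sub>R
       Bochner_integral (lebesgue_on {t\<^sub>0..t}) (\<lambda>s. (t - s) powr (\<alpha> - 1) *\<^sub>R f s)"

end

theory Submission
  imports Defs "HOL-Real_Asymp.Real_Asymp"
begin

text \<open>
  Fractional integration of order \<open>\<alpha>\<close> raises the growth exponent of a power function by \<open>\<alpha>\<close>. On a
  half line this destroys \<open>p\<close>-integrability at infinity: \<open>u powr (- \<beta>)\<close> is \<open>p\<close>-integrable near infinity
  only for \<open>\<beta> > 1 / p\<close>, so a function which decays just slightly faster than the critical rate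
  \<open>1 / p\<close> lies in \<open>L\<^sup>p\<close>, while its fractional integral decays slower than that rate. The example is
  \<open>f s = (1 + (s - t\<^sub>0)) powr (- \<beta>) *\<^sub>R x\<close> with a nonzero vector \<open>x\<close> and \<open>\<beta> = 1 / p + \<alpha> / 2\<close>, where \<open>1 / p\<close>
  is read as \<open>0\<close> for \<open>p = \<infinity>\<close>: half of the gain \<open>\<alpha>\<close> keeps \<open>f\<close> inside \<open>L\<^sup>p\<close>, the other half pushes the
  fractional integral out of it.

  No exact evaluation of the fractional integral is needed. As the scalar factor \<open>g\<close> decreases, it is
  at least \<open>g t\<close> on \<open>{t\<^sub>0..t}\<close>, and the kernel alone integrates to \<open>(t - t\<^sub>0) powr \<alpha> / \<alpha>\<close>; this is
  \<open>norm_RL_integral_antimono_ge\<close>. For \<open>t \<ge> t\<^sub>0 + 1\<close> the resulting bound is a constant times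
  \<open>(1 + (t - t\<^sub>0)) powr (\<alpha> / 2 - 1 / p)\<close>, which is unbounded if \<open>p = \<infinity>\<close>, and whose \<open>p\<close>-th power dominates
  the harmonic function \<open>1 / (1 + (t - t\<^sub>0))\<close> otherwise.

  All functions involved take values in the line spanned by \<open>x\<close>, so Bochner integrals reduce to
  scalar Lebesgue integrals (\<open>Bochner_integral_scaleR_left\<close>).
\<close>

section \<open>Bochner integration of functions with values in a line\<close>

lemma sigma_finite_lebesgue_on:
  fixes S :: "'a::euclidean_space set"
  assumes "S \<in> sets lebesgue"
  shows "sigma_finite_measure (lebesgue_on S)"
proof (rule sigma_finite_measure_restrict_space[OF _ assms])
  show "sigma_finite_measure (lebesgue :: 'a measure)"
  proof
    have "(\<Union>n::nat. cball 0 (real n)) = (UNIV :: 'a set)"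
      by (auto simp: real_arch_simple)
    moreover have "emeasure lebesgue (cball (0::'a) (real n)) \<noteq> \<infinity>" for n
      using emeasure_lborel_cball_finite[of "0::'a" "real n"] by simp
    ultimately show "\<exists>A::'a set set. countable A \<and> A \<subseteq> sets lebesgue \<and> \<Union>A = space lebesgue \<and>
        (\<forall>a\<in>A. emeasure lebesgue a \<noteq> \<infinity>)"
      by (intro exI[of _ "range (\<lambda>n::nat. cball 0 (real n))"]) (auto simp: image_subset_iff)
  qed
qed

lemma simple_bochner_integrable_scaleR_left:
  fixes x :: "'b::real_vector"
  assumes "Bochner_Integration.simple_bochner_integrable M (s :: 'a \<Rightarrow> real)"
  shows "Bochner_Integration.simple_bochner_integrable M (\<lambda>z. s z *\<^sub>R x)"
  using simple_bochner_integrable_compose2[of "\<lambda>a b. a *\<^sub>R x" M s s] assms by simp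

text \<open>
  Simple functions approximating \<open>g\<close> need not have support of finite measure. Cutting them off
  along an exhaustion of the space by sets of finite measure makes them integrable, and at each
  point the cut-off is eventually invisible.
\<close>
lemma strongly_measurable_scaleR_left:
  fixes g :: "'a \<Rightarrow> real" and x :: "'b::real_normed_vector"
  assumes "sigma_finite_measure M" and g: "g \<in> borel_measurable M"
  shows "strongly_measurable M (\<lambda>z. g z *\<^sub>R x)"
proof -
  obtain A :: "nat \<Rightarrow> 'a set" where A: "range A \<subseteq> sets M" "(\<Union>i. A i) = space M"
      "\<And>i. emeasure M (A i) \<noteq> \<infinity>" "incseq A"
    using sigma_finite_measure.sigma_finite_incseq[OF assms(1)] by metis
  obtain F where F: "\<And>i. simple_function M (F i)"
      "\<And>z. z \<in> space M \<Longrightarrow> (\<lambda>i. F i z) \<longlonglongrightarrow> g z"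
    using borel_measurable_implies_sequence_metric[OF g, of 0] by metis
  define s where "s i z = F i z * indicator (A i) z" for i z
  have "Bochner_Integration.simple_bochner_integrable M (s i)" for i
  proof
    show sf: "simple_function M (s i)"
      unfolding s_def using A(1) by (intro simple_function_mult F simple_function_indicator) auto
    have "emeasure M {z \<in> space M. s i z \<noteq> 0} \<le> emeasure M (A i)"
      using A(1) by (intro emeasure_mono) (auto simp: s_def indicator_def split: if_splits)
    then show "emeasure M {z \<in> space M. s i z \<noteq> 0} \<noteq> \<infinity>"
      using A(3)[of i] by (auto simp: top_unique)
  qed
  moreover have "(\<lambda>i. s i z *\<^sub>R x) \<longlonglongrightarrow> g z *\<^sub>R x" if z: "z \<in> space M" for z
  proof -
    from z A(2) obtain k where "z \<in> A k" by auto
    then have "eventually (\<lambda>i. F i z = s i z) sequentially"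
      using A(4) unfolding eventually_sequentially s_def incseq_def
      by (intro exI[of _ k]) (auto simp: indicator_def)
    from F(2)[OF z] this have "(\<lambda>i. s i z) \<longlonglongrightarrow> g z"
      by (rule Lim_transform_eventually)
    then show ?thesis by (intro tendsto_intros)
  qed
  ultimately show ?thesis
    unfolding strongly_measurable_def
    by (intro exI[of _ "\<lambda>i z. s i z *\<^sub>R x"]) (auto intro: simple_bochner_integrable_scaleR_left)
qed

text \<open>
  An approximation of \<open>g\<close> in \<open>L\<^sup>1\<close> by simple functions becomes one of \<open>g *\<^sub>R x\<close> after multiplication
  with \<open>x\<close>, which scales the \<open>L\<^sup>1\<close>-distances by \<open>norm x\<close> only. Hence the result holds in spaces that
  are not separable too.
\<close>
lemma Bochner_integral_scaleR_left:
  fixes g :: "'a \<Rightarrow> real" and x :: "'b::real_normed_vector"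
  assumes M: "sigma_finite_measure M" and g: "integrable M g"
  shows "Bochner_integral M (\<lambda>z. g z *\<^sub>R x) = integral\<^sup>L M g *\<^sub>R x"
proof (rule Bochner_integral_eq)
  obtain s where meas: "g \<in> borel_measurable M"
    and s: "\<And>i. Bochner_Integration.simple_bochner_integrable M (s i)"
    and L1: "(\<lambda>i. \<integral>\<^sup>+z. norm (g z - s i z) \<partial>M) \<longlonglongrightarrow> 0"
    and I: "(\<lambda>i. Bochner_Integration.simple_bochner_integral M (s i)) \<longlonglongrightarrow> integral\<^sup>L M g"
    using has_bochner_integral_integrable[OF g] by (rule has_bochner_integral.cases) metis
  have "(\<lambda>i. \<integral>\<^sup>+z. norm (g z *\<^sub>R x - s i z *\<^sub>R x) \<partial>M) \<longlonglongrightarrow> 0"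
  proof -
    have "(\<integral>\<^sup>+z. norm (g z *\<^sub>R x - s i z *\<^sub>R x) \<partial>M) = (\<integral>\<^sup>+z. norm (g z - s i z) \<partial>M) * norm x" for i
    proof -
      have [measurable]: "s i \<in> borel_measurable M"
        using s[of i] by (auto elim!: Bochner_Integration.simple_bochner_integrable.cases
            intro: borel_measurable_simple_function)
      note meas[measurable]
      show ?thesis
        by (subst nn_integral_multc[symmetric])
          (auto simp: ennreal_mult' scaleR_diff_left[symmetric] mult.commute)
    qed
    then show ?thesis
      using tendsto_mult_ennreal[OF L1 tendsto_const[of "ennreal (norm x)"]] by simp
  qed
  moreover have "Bochner_Integration.simple_bochner_integral M (\<lambda>z. s i z *\<^sub>R x) =
      Bochner_Integration.simple_bochner_integral M (s i) *\<^sub>R x" for i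
    using simple_bochner_integral_linear[OF _ s[of i], of "\<lambda>r. r *\<^sub>R x"]
    by (simp add: bounded_linear.linear bounded_linear_scaleR_left)
  ultimately show "has_Bochner_integral M (\<lambda>z. g z *\<^sub>R x) (integral\<^sup>L M g *\<^sub>R x)"
    unfolding has_Bochner_integral_def
    using strongly_measurable_scaleR_left[OF M meas] s
    by (intro conjI exI[of _ "\<lambda>i z. s i z *\<^sub>R x"])
      (auto intro!: simple_bochner_integrable_scaleR_left tendsto_scaleR I)
qed

section \<open>A lower bound for the fractional integral\<close>

lemma has_bochner_integral_RL_kernel:
  fixes a t \<alpha> :: real
  assumes \<alpha>: "\<alpha> > 0" and t: "a \<le> t"
  shows "has_bochner_integral (lebesgue_on {a..t}) (\<lambda>s. (t - s) powr (\<alpha> - 1)) ((t - a) powr \<alpha> / \<alpha>)"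
proof -
  let ?k = "\<lambda>s. (t - s) powr (\<alpha> - 1)"
  have "((\<lambda>u. u powr (\<alpha> - 1)) has_integral (t - a) powr \<alpha> / \<alpha>) {0..t - a}"
    using has_integral_powr_from_0[of "\<alpha> - 1" "t - a"] \<alpha> t by simp
  from has_integral_affinity[of _ _ 0 "t - a" "-1" t, simplified, OF this]
  have *: "(?k has_integral (t - a) powr \<alpha> / \<alpha>) {a..t}"
    using t by (simp add: image_diff_atLeastAtMost)
  then have "integrable (lebesgue_on {a..t}) ?k"
    by (intro absolutely_integrable_imp_integrable nonnegative_absolutely_integrable_1)
      (auto simp: has_integral_integrable)
  moreover from this have "integral\<^sup>L (lebesgue_on {a..t}) ?k = (t - a) powr \<alpha> / \<alpha>"
    using * by (simp add: lebesgue_integral_eq_integral integral_unique)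
  ultimately show ?thesis by (simp add: has_bochner_integral_iff)
qed

text \<open>
  Replacing \<open>g\<close> by its smallest value \<open>g t\<close> leaves the integral of the kernel. The left side is thus
  the norm of the fractional integral at \<open>t\<close> of a constant function. Monotonicity also bounds \<open>g\<close> by
  \<open>g a\<close>, so that the integral exists at every single \<open>t\<close> and its default value never enters.
\<close>
lemma norm_RL_integral_antimono_ge:
  fixes g :: "real \<Rightarrow> real" and x :: "'x::real_normed_vector"
  assumes \<alpha>: "\<alpha> > 0" and t: "a \<le> t"
    and meas: "g \<in> borel_measurable (lebesgue_on {a..t})"
    and anti: "antimono_on {a..t} g" and nonneg: "0 \<le> g t"
  shows "g t * (t - a) powr \<alpha> / Gamma (\<alpha> + 1) * norm x \<le> norm (RL_integral \<alpha> a (\<lambda>s. g s *\<^sub>R x) t)"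
proof -
  let ?M = "lebesgue_on {a..t}"
  define k where "k s = (t - s) powr (\<alpha> - 1)" for s
  have k: "has_bochner_integral ?M k ((t - a) powr \<alpha> / \<alpha>)"
    unfolding k_def by (rule has_bochner_integral_RL_kernel[OF \<alpha> t])
  have g_ge: "g t \<le> g s" and g_le: "g s \<le> g a" if "s \<in> {a..t}" for s
    using anti that t by (auto simp: monotone_on_def)
  have intk: "integrable ?M k" and valk: "integral\<^sup>L ?M k = (t - a) powr \<alpha> / \<alpha>"
    using k by (auto simp: has_bochner_integral_iff)
  have int: "integrable ?M (\<lambda>s. k s * g s)"
  proof (rule Bochner_Integration.integrable_bound[where f = "\<lambda>s. k s * g a"])
    show "AE s in ?M. norm (k s * g s) \<le> norm (k s * g a)"
    proof (rule AE_I2)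
      fix s assume "s \<in> space ?M"
      then have "0 \<le> g s" "g s \<le> g a" using g_ge[of s] g_le[of s] nonneg by auto
      then show "norm (k s * g s) \<le> norm (k s * g a)"
        by (simp add: abs_mult mult_left_mono)
    qed
  qed (use intk meas in auto)
  have "(t - a) powr \<alpha> / \<alpha> * g t = integral\<^sup>L ?M (\<lambda>s. k s * g t)"
    using valk by simp
  also have "\<dots> \<le> integral\<^sup>L ?M (\<lambda>s. k s * g s)"
    
  proof (rule integral_mono)
    show "k s * g t \<le> k s * g s" if "s \<in> space ?M" for s
      using g_ge[of s] that by (auto simp: k_def intro!: mult_left_mono)
  qed (use intk int in auto)
  finally have le: "(t - a) powr \<alpha> / \<alpha> * g t \<le> integral\<^sup>L ?M (\<lambda>s. k s * g s)" .
  have "0 \<le> (t - a) powr \<alpha> / \<alpha> * g t" using \<alpha> nonneg by simp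
  with le have pos: "0 \<le> integral\<^sup>L ?M (\<lambda>s. k s * g s)" by linarith
  have "RL_integral \<alpha> a (\<lambda>s. g s *\<^sub>R x) t = (1 / Gamma \<alpha>) *\<^sub>R integral\<^sup>L ?M (\<lambda>s. k s * g s) *\<^sub>R x"
    unfolding RL_integral_def
    using Bochner_integral_scaleR_left[OF sigma_finite_lebesgue_on int, of x]
    by (simp add: k_def)
  then have norm_eq: "norm (RL_integral \<alpha> a (\<lambda>s. g s *\<^sub>R x) t) =
      integral\<^sup>L ?M (\<lambda>s. k s * g s) / Gamma \<alpha> * norm x"
    using pos Gamma_real_pos[OF \<alpha>] by simp
  have "Gamma (\<alpha> + 1) = \<alpha> * Gamma \<alpha>"
    using \<alpha> by (intro Gamma_plus1) auto
  then have "g t * (t - a) powr \<alpha> / Gamma (\<alpha> + 1) = (t - a) powr \<alpha> / \<alpha> * g t / Gamma \<alpha>"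
    by simp
  also have "\<dots> \<le> integral\<^sup>L ?M (\<lambda>s. k s * g s) / Gamma \<alpha>"
    using le Gamma_real_pos[OF \<alpha>] by (intro divide_right_mono) auto
  finally show ?thesis
    unfolding norm_eq by (intro mult_right_mono) auto
qed

section \<open>Integrability of powers at infinity\<close>

lemma nn_integral_lebesgue_on:
  fixes f :: "'a::euclidean_space \<Rightarrow> ennreal"
  assumes "S \<in> sets borel" "f \<in> borel_measurable borel"
  shows "(\<integral>\<^sup>+s. f s \<partial>lebesgue_on S) = (\<integral>\<^sup>+s. f s * indicator S s \<partial>lborel)"
  using assms by (simp add: nn_integral_restrict_space nn_integral_completion)

lemma nn_integral_shifted_powr_finite:
  fixes a \<gamma> :: real
  assumes \<gamma>: "\<gamma> > 1"
  shows "(\<integral>\<^sup>+s. ennreal ((1 + (s - a)) powr (- \<gamma>)) \<partial>lebesgue_on {a..}) < \<infinity>"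
proof -
  have "((\<lambda>s. (1 + (s - a)) powr (1 - \<gamma>) / (1 - \<gamma>)) \<longlongrightarrow> 0 / (1 - \<gamma>)) at_top"
  proof (intro tendsto_divide tendsto_const tendsto_neg_powr)
    show "filterlim (\<lambda>s. 1 + (s - a)) at_top at_top"
      using filterlim_tendsto_add_at_top[OF tendsto_const[of "1 - a"] filterlim_ident]
      by (simp add: algebra_simps)
  qed (use \<gamma> in auto)
  moreover have "((\<lambda>s. (1 + (s - a)) powr (1 - \<gamma>) / (1 - \<gamma>)) has_real_derivative
      (1 + (s - a)) powr (- \<gamma>)) (at s)" if "a \<le> s" for s
    using that \<gamma> by (auto intro!: derivative_eq_intros)
  ultimately have "(\<integral>\<^sup>+s. ennreal ((1 + (s - a)) powr (- \<gamma>)) * indicator {a..} s \<partial>lborel) =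
      0 / (1 - \<gamma>) - (1 + (a - a)) powr (1 - \<gamma>) / (1 - \<gamma>)"
    by (intro nn_integral_FTC_atLeast) auto
  then show ?thesis
    by (simp add: nn_integral_lebesgue_on)
qed

text \<open>
  Logarithmic divergence. As only the harmonic minorant is integrated, \<open>h\<close> may be the \<open>p\<close>-th power of
  the norm of a fractional integral without a prior proof that this function is measurable.
\<close>
lemma nn_integral_harmonic_tail_infinite:
  fixes a c :: real and h :: "real \<Rightarrow> real"
  assumes c: "c > 0" and ge: "\<And>s. a + 1 \<le> s \<Longrightarrow> c / (1 + (s - a)) \<le> h s"
  shows "(\<integral>\<^sup>+s. ennreal (h s) \<partial>lebesgue_on {a..}) = \<infinity>"
proof (rule ccontr)
  let ?I = "\<integral>\<^sup>+s. ennreal (h s) \<partial>lebesgue_on {a..}"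
  assume "?I \<noteq> \<infinity>"
  then obtain r where r: "r \<ge> 0" "?I = ennreal r" by (cases ?I) auto
  \<comment> \<open>Chosen so that \<open>c / (1 + (s - a))\<close> has integral \<open>r + 1\<close> over \<open>{a + 1..a + T - 1}\<close>.\<close>
  define T where "T = 2 * exp ((r + 1) / c)"
  have T: "T \<ge> 2" using r c by (simp add: T_def)
  have "ln T = ln 2 + (r + 1) / c"
    by (simp add: T_def ln_mult)
  then have "c * ln T - c * ln 2 = r + 1"
    using c by (simp add: field_simps)
  then have "r + 1 = c * ln (1 + (a + T - 1 - a)) - c * ln (1 + (a + 1 - a))"
    by simp
  then have "ennreal (r + 1) = ennreal (c * ln (1 + (a + T - 1 - a)) - c * ln (1 + (a + 1 - a)))"
    by (rule arg_cong)
  also have "\<dots> = (\<integral>\<^sup>+s. ennreal (c / (1 + (s - a))) * indicator {a + 1..a + T - 1} s \<partial>lborel)"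
  proof (rule nn_integral_FTC_Icc[symmetric])
    show "((\<lambda>s. c * ln (1 + (s - a))) has_real_derivative c / (1 + (s - a))) (at s)"
      if "s \<in> {a + 1..a + T - 1}" for s
      using that by (auto intro!: derivative_eq_intros)
    show "0 \<le> c / (1 + (s - a))" if "s \<in> {a + 1..a + T - 1}" for s
      using that c by auto
  qed (use T in auto)
  also have "\<dots> = (\<integral>\<^sup>+s. ennreal (c / (1 + (s - a))) * indicator {a + 1..a + T - 1} s \<partial>lebesgue)"
    by (simp add: nn_integral_completion)
  also have "\<dots> \<le> (\<integral>\<^sup>+s. ennreal (h s) * indicator {a..} s \<partial>lebesgue)"
    by (intro nn_integral_mono) (auto simp: indicator_def ge intro!: ennreal_leI)
  also have "\<dots> = ennreal r"
    using r by (simp add: nn_integral_restrict_space)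
  finally show False using r by simp
qed

lemma not_essentially_bounded_at_top:
  fixes f :: "real \<Rightarrow> real"
  assumes "filterlim f at_top at_top"
  shows "\<not> (AE s in lebesgue_on {a..}. f s \<le> C)"
proof
  assume ae: "AE s in lebesgue_on {a..}. f s \<le> C"
  obtain T where T: "\<And>s. T \<le> s \<Longrightarrow> C < f s"
    using assms by (auto simp: filterlim_at_top_dense eventually_at_top_linorder)
  have "AE s in lebesgue. s \<in> {a..} \<longrightarrow> f s \<le> C"
    using ae by (simp add: AE_restrict_space_iff)
  then have "AE s in lebesgue. s \<notin> {max a T..max a T + 1}"
    by eventually_elim (use T in fastforce)
  moreover have "{s \<in> space lebesgue. \<not> s \<notin> {max a T..max a T + 1}} = {max a T..max a T + 1}"
    by auto
  ultimately have "emeasure lebesgue {max a T..max a T + 1} = 0"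
    using AE_iff_measurable[of "{max a T..max a T + 1}" lebesgue] by simp
  then show False by simp
qed

section \<open>The fractional integral leaves every Lebesgue space\<close>

theorem theorem32:
  fixes t\<^sub>0 \<alpha> :: real and p :: ennreal
  assumes "(UNIV :: 'x::banach set) \<noteq> {0}"
    and "1 \<le> p"
    and "\<alpha> > 0"
  shows "\<exists>f :: real \<Rightarrow> 'x. f \<in> Bochner_Lp p (lebesgue_on {t\<^sub>0..}) \<and>
           RL_integral \<alpha> t\<^sub>0 f \<notin> Bochner_Lp p (lebesgue_on {t\<^sub>0..})"
proof -
  obtain x :: 'x where x: "x \<noteq> 0" using assms(1) by auto
  \<comment> \<open>For \<open>p = \<infinity>\<close> the conversion gives \<open>q = 0\<close>, hence \<open>1 / q = 0\<close> and \<open>\<beta> = \<alpha> / 2\<close>, as desired.\<close>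
  define q where "q = enn2real p"
  define \<beta> where "\<beta> = 1 / q + \<alpha> / 2"
  define g where "g s = (1 + (s - t\<^sub>0)) powr (- \<beta>)" for s
  define c where "c = norm x / (2 powr \<alpha> * Gamma (\<alpha> + 1))"
  have q: "q \<ge> 1" if "p \<noteq> \<infinity>"
    using that assms(2) unfolding q_def by (cases p) auto
  have q0: "q \<ge> 0" by (simp add: q_def)
  have \<beta>: "\<beta> > 0" using q0 assms(3) by (simp add: \<beta>_def add_nonneg_pos)
  have c: "c > 0" using x assms(3) by (simp add: c_def Gamma_real_pos)
  have g_meas: "g \<in> borel_measurable (lebesgue_on S)" for S
    unfolding g_def by (intro measurable_restrict_space1 measurable_completion) auto
  have lower: "c * (1 + (t - t\<^sub>0)) powr (\<alpha> - \<beta>) \<le> norm (RL_integral \<alpha> t\<^sub>0 (\<lambda>s. g s *\<^sub>R x) t)"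
    if t: "t\<^sub>0 + 1 \<le> t" for t
  proof -
    have "antimono_on {t\<^sub>0..t} g"
      using \<beta> by (auto simp: g_def intro!: monotone_onI powr_mono2')
    then have "g t * (t - t\<^sub>0) powr \<alpha> / Gamma (\<alpha> + 1) * norm x \<le> norm (RL_integral \<alpha> t\<^sub>0 (\<lambda>s. g s *\<^sub>R x) t)"
      using t assms(3) g_meas by (intro norm_RL_integral_antimono_ge) (auto simp: g_def[of t])
    \<comment> \<open>This is where \<open>t\<^sub>0 + 1 \<le> t\<close> enters; it costs the factor \<open>2 powr \<alpha>\<close> in \<open>c\<close>.\<close>
    moreover have "((1 + (t - t\<^sub>0)) / 2) powr \<alpha> \<le> (t - t\<^sub>0) powr \<alpha>"
      using t assms(3) by (intro powr_mono2) auto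
    then have "g t * ((1 + (t - t\<^sub>0)) / 2) powr \<alpha> / Gamma (\<alpha> + 1) * norm x
        \<le> g t * (t - t\<^sub>0) powr \<alpha> / Gamma (\<alpha> + 1) * norm x"
      using assms(3)
      by (intro mult_right_mono divide_right_mono mult_left_mono) (auto simp: g_def Gamma_real_pos less_imp_le)
    moreover have "g t * ((1 + (t - t\<^sub>0)) / 2) powr \<alpha> / Gamma (\<alpha> + 1) * norm x =
        c * (1 + (t - t\<^sub>0)) powr (\<alpha> - \<beta>)"
      using t by (simp add: g_def c_def powr_divide powr_diff powr_minus field_simps)
    ultimately show ?thesis by simp
  qed
  have "strongly_measurable (lebesgue_on {t\<^sub>0..}) (\<lambda>s. g s *\<^sub>R x)"
    by (intro strongly_measurable_scaleR_left sigma_finite_lebesgue_on g_meas) auto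
  moreover have "if p = \<infinity> then \<exists>C. AE s in lebesgue_on {t\<^sub>0..}. norm (g s *\<^sub>R x) \<le> C
      else (\<integral>\<^sup>+s. ennreal (norm (g s *\<^sub>R x) powr q) \<partial>lebesgue_on {t\<^sub>0..}) < \<infinity>"
  proof (cases "p = \<infinity>")
    case True
    have "g s \<le> 1" if "t\<^sub>0 \<le> s" for s
      using that \<beta> powr_mono2'[of "-\<beta>" 1 "1 + (s - t\<^sub>0)"] by (simp add: g_def)
    then have "AE s in lebesgue_on {t\<^sub>0..}. norm (g s *\<^sub>R x) \<le> norm x"
      by (intro AE_I2) (auto simp: g_def mult_left_le_one_le)
    then show ?thesis using True by auto
  next
    case False
    have "\<beta> * q = 1 + \<alpha> * q / 2" using q[OF False] by (simp add: \<beta>_def field_simps)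
    then have "\<beta> * q > 1" using q[OF False] assms(3) by simp
    then have "(\<integral>\<^sup>+s. ennreal ((1 + (s - t\<^sub>0)) powr (- (\<beta> * q))) \<partial>lebesgue_on {t\<^sub>0..}) < \<infinity>"
      by (rule nn_integral_shifted_powr_finite)
    moreover have "(\<lambda>s. (1 + (s - t\<^sub>0)) powr (- (\<beta> * q))) \<in> borel_measurable (lebesgue_on {t\<^sub>0..})"
      by (intro measurable_restrict_space1 measurable_completion) auto
    moreover have "norm (g s *\<^sub>R x) powr q = norm x powr q * (1 + (s - t\<^sub>0)) powr (- (\<beta> * q))" for s
      by (simp add: g_def powr_mult powr_powr)
    ultimately show ?thesis
      using False by (simp add: ennreal_mult nn_integral_cmult ennreal_mult_less_top)
  qed
  ultimately have "(\<lambda>s. g s *\<^sub>R x) \<in> Bochner_Lp p (lebesgue_on {t\<^sub>0..})"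
    unfolding Bochner_Lp_def q_def by (intro CollectI conjI)
  moreover have "RL_integral \<alpha> t\<^sub>0 (\<lambda>s. g s *\<^sub>R x) \<notin> Bochner_Lp p (lebesgue_on {t\<^sub>0..})"
  proof (cases "p = \<infinity>")
    case True
    then have "\<alpha> - \<beta> = \<alpha> / 2" by (simp add: \<beta>_def q_def)
    have "filterlim (\<lambda>t. 1 + (t - t\<^sub>0)) at_top at_top"
      using filterlim_tendsto_add_at_top[OF tendsto_const[of "1 - t\<^sub>0"] filterlim_ident]
      by (simp add: algebra_simps)
    then have "filterlim (\<lambda>t. c * (1 + (t - t\<^sub>0)) powr (\<alpha> - \<beta>)) at_top at_top"
      unfolding \<open>\<alpha> - \<beta> = \<alpha> / 2\<close> using c assms(3)
      by (intro filterlim_tendsto_pos_mult_at_top[OF tendsto_const] filterlim_compose[OF real_powr_at_top]) auto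
    then have "filterlim (\<lambda>t. norm (RL_integral \<alpha> t\<^sub>0 (\<lambda>s. g s *\<^sub>R x) t)) at_top at_top"
      by (rule filterlim_at_top_mono)
        (use lower in \<open>auto simp: eventually_at_top_linorder\<close>)
    then show ?thesis
      using not_essentially_bounded_at_top True unfolding Bochner_Lp_def by auto
  next
    case False
    have "c powr q / (1 + (t - t\<^sub>0)) \<le> norm (RL_integral \<alpha> t\<^sub>0 (\<lambda>s. g s *\<^sub>R x) t) powr q"
      if t: "t\<^sub>0 + 1 \<le> t" for t
    proof -
      \<comment> \<open>Indeed \<open>(\<alpha> - \<beta>) * q = \<alpha> * q / 2 - 1\<close>.\<close>
      have "- 1 \<le> (\<alpha> - \<beta>) * q" using q[OF False] assms(3) by (simp add: \<beta>_def field_simps)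
      then have "c powr q * (1 + (t - t\<^sub>0)) powr (- 1) \<le> c powr q * (1 + (t - t\<^sub>0)) powr ((\<alpha> - \<beta>) * q)"
        using t by (intro mult_left_mono powr_mono) auto
      also have "\<dots> = (c * (1 + (t - t\<^sub>0)) powr (\<alpha> - \<beta>)) powr q"
        using c by (simp add: powr_mult powr_powr)
      also have "\<dots> \<le> norm (RL_integral \<alpha> t\<^sub>0 (\<lambda>s. g s *\<^sub>R x) t) powr q"
        using lower[OF t] c q0 by (intro powr_mono2) auto
      finally show ?thesis using t by (simp add: powr_minus_divide)
    qed
    then have "(\<integral>\<^sup>+t. ennreal (norm (RL_integral \<alpha> t\<^sub>0 (\<lambda>s. g s *\<^sub>R x) t) powr q) \<partial>lebesgue_on {t\<^sub>0..}) = \<infinity>"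
      using c by (intro nn_integral_harmonic_tail_infinite[of "c powr q"]) auto
    then show ?thesis using False by (simp add: Bochner_Lp_def q_def)
  qed
  ultimately show ?thesis by blast
qed

end
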